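(* Let $\mathscr{R}$ be a von Neumann algebra. If $\mathscr{I}$ is a norm-closed left ideal of $\mathscr{R}$ which is countably generated, then $\mathscr{I}$ is weak-operator closed (and thus $\mathscr{I} = \mathscr{R}E$ for some projection $E$, a principal left ideal).
   Context: For a family $\mathcal{S}$ of operators in $\mathscr{R}$, $\langle \mathscr{R}\mathcal{S}\rangle$ denotes the smallest left ideal of $\mathscr{R}$ containing $\mathcal{S}$ (the left ideal generated by $\mathcal{S}$). A left ideal $\mathscr{I}$ is countably generated if $\mathscr{I} = \langle\mathscr{R}\mathcal{S}\rangle$ for some countable subset $\mathcal{S}$ of $\mathscr{R}$; generation is meant in the purely algebraic sense (no closure is taken). *)

theory Defs
  imports "HOL-Analysis.Analysis"
begin

class chilbert_space = ab_group_add +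
  fixes scaleC :: "complex \<Rightarrow> 'a \<Rightarrow> 'a"
    and cinner :: "'a \<Rightarrow> 'a \<Rightarrow> complex"
  assumes scaleC_add_right: "scaleC a (x + y) = scaleC a x + scaleC a y"
    and scaleC_add_left: "scaleC (a + b) x = scaleC a x + scaleC b x"
    and scaleC_scaleC: "scaleC a (scaleC b x) = scaleC (a * b) x"
    and scaleC_one: "scaleC 1 x = x"
    and cinner_add_left: "cinner (x + y) z = cinner x z + cinner y z"
    and cinner_scaleC_left: "cinner (scaleC a x) y = a * cinner x y"
    and cinner_commute: "cinner y x = cnj (cinner x y)"
    and cinner_nonneg: "Im (cinner x x) = 0 \<and> Re (cinner x x) \<ge> 0"
    and cinner_eq_zero: "cinner x x = 0 \<Longrightarrow> x = 0"
    and hilbert_complete: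
      "(\<forall>e>0. \<exists>N. \<forall>m\<ge>N. \<forall>n\<ge>N. sqrt (Re (cinner (X m - X n) (X m - X n))) < e)
       \<Longrightarrow> (\<exists>L. (\<lambda>n. sqrt (Re (cinner (X n - L) (X n - L)))) \<longlonglongrightarrow> 0)"

definition hnorm :: "'a::chilbert_space \<Rightarrow> real" where
  "hnorm x = sqrt (Re (cinner x x))"

definition bounded_op :: "('a::chilbert_space \<Rightarrow> 'a) \<Rightarrow> bool" where
  "bounded_op T \<longleftrightarrow> (\<forall>x y. T (x + y) = T x + T y) \<and> (\<forall>a x. T (scaleC a x) = scaleC a (T x))
     \<and> (\<exists>K. \<forall>x. hnorm (T x) \<le> K * hnorm x)"

definition is_adjoint :: "('a::chilbert_space \<Rightarrow> 'a) \<Rightarrow> ('a \<Rightarrow> 'a) \<Rightarrow> bool" where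
  "is_adjoint T S \<longleftrightarrow> (\<forall>x y. cinner (T x) y = cinner x (S y))"

text \<open>Closedness in the weak-operator topology of B(H): every bounded operator in the
WOT-closure (basic WOT neighbourhoods given by finitely many pairs of vectors) belongs to S.\<close>
definition wot_closed :: "('a::chilbert_space \<Rightarrow> 'a) set \<Rightarrow> bool" where
  "wot_closed S \<longleftrightarrow> (\<forall>T. bounded_op T \<and>
     (\<forall>F. finite F \<longrightarrow> (\<forall>e>0. \<exists>A\<in>S. \<forall>(x, y)\<in>F. cmod (cinner (T x - A x) y) < e))
     \<longrightarrow> T \<in> S)"

definition norm_closed :: "('a::chilbert_space \<Rightarrow> 'a) set \<Rightarrow> bool" where
  "norm_closed S \<longleftrightarrow> (\<forall>T. bounded_op T \<and>
     (\<forall>e>0. \<exists>A\<in>S. \<forall>x. hnorm (T x - A x) \<le> e * hnorm x) \<longrightarrow> T \<in> S)"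

definition von_neumann_algebra :: "('a::chilbert_space \<Rightarrow> 'a) set \<Rightarrow> bool" where
  "von_neumann_algebra R \<longleftrightarrow>
     (\<forall>A\<in>R. bounded_op A) \<and> id \<in> R \<and>
     (\<forall>A\<in>R. \<forall>B\<in>R. (\<lambda>x. A x + B x) \<in> R) \<and>
     (\<forall>A\<in>R. \<forall>a. (\<lambda>x. scaleC a (A x)) \<in> R) \<and>
     (\<forall>A\<in>R. \<forall>B\<in>R. A \<circ> B \<in> R) \<and>
     (\<forall>A\<in>R. \<exists>B\<in>R. is_adjoint A B) \<and>
     wot_closed R"

definition left_ideal :: "('a::chilbert_space \<Rightarrow> 'a) set \<Rightarrow> ('a \<Rightarrow> 'a) set \<Rightarrow> bool" where
  "left_ideal R I \<longleftrightarrow> I \<subseteq> R \<and> (\<lambda>_. 0) \<in> I \<and>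
     (\<forall>A\<in>I. \<forall>B\<in>I. (\<lambda>x. A x + B x) \<in> I) \<and>
     (\<forall>A\<in>I. \<forall>a. (\<lambda>x. scaleC a (A x)) \<in> I) \<and>
     (\<forall>A\<in>R. \<forall>B\<in>I. A \<circ> B \<in> I)"

definition gen_left_ideal :: "('a::chilbert_space \<Rightarrow> 'a) set \<Rightarrow> ('a \<Rightarrow> 'a) set \<Rightarrow> ('a \<Rightarrow> 'a) set" where
  "gen_left_ideal R S = \<Inter>{I. left_ideal R I \<and> S \<subseteq> I}"

definition countably_generated :: "('a::chilbert_space \<Rightarrow> 'a) set \<Rightarrow> ('a \<Rightarrow> 'a) set \<Rightarrow> bool" where
  "countably_generated R I \<longleftrightarrow> (\<exists>S. S \<subseteq> R \<and> countable S \<and> I = gen_left_ideal R S)"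

definition projection :: "('a::chilbert_space \<Rightarrow> 'a) \<Rightarrow> bool" where
  "projection E \<longleftrightarrow> E \<circ> E = E \<and> is_adjoint E E"

end

(* Let T_0, T_1, ... generate the norm-closed left ideal I.  A norm-convergent sum H of small
   multiples of T_k^* T_k lies in I, satisfies 0 <= H <= 1, and dominates I: every A in I has
   |A x|^2 <= c <H x, x>, because the operators with such a bound form a left ideal containing all
   T_k.  Put X = 1 - H.  The operators 1 - X^m belong to I, and a gliding hump argument makes c
   uniform in m.  Applied to X^n y this gives |X^n y - X^(n+m) y|^2 <= c (a_(2n) - a_(2n+1)) where
   a_n = <X^n y, y> is decreasing and convex with a_0 = |y|^2; hence the right side is at most
   c |y|^2 / (2n+1), and 1 - X^n converges in norm to some E in I.  Since H (1 - E) = 0,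
   domination gives A (1 - E) = 0 for all A in I, so E is a projection with I = R E. *)
theory Submission
  imports Defs
begin

section \<open>Hilbert spaces\<close>

lemma scaleC_zero_left [simp]: "scaleC 0 x = (0 :: 'a::chilbert_space)"
  using scaleC_add_left [of 0 0 x] by simp

lemma scaleC_zero_right [simp]: "scaleC a 0 = (0 :: 'a::chilbert_space)"
  using scaleC_add_right [of a 0 0] by simp

lemma scaleC_minus_one [simp]: "scaleC (- 1) x = - (x :: 'a::chilbert_space)"
  using scaleC_add_left [of 1 "-1" x] by (simp add: scaleC_one eq_neg_iff_add_eq_0 add.commute)

lemma scaleC_diff_right: "scaleC a (x - y) = scaleC a x - scaleC a (y :: 'a::chilbert_space)"
  using scaleC_add_right [of a "x - y" y] by (simp add: eq_diff_eq)

lemma cinner_zero_left [simp]: "cinner 0 (y :: 'a::chilbert_space) = 0"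
  using cinner_add_left [of 0 0 y] by simp

lemma cinner_zero_right [simp]: "cinner (x :: 'a::chilbert_space) 0 = 0"
  using cinner_commute [of 0 x] by simp

lemma cinner_minus_left: "cinner (- x) y = - cinner x (y :: 'a::chilbert_space)"
  using cinner_add_left [of x "-x" y] by (simp add: eq_neg_iff_add_eq_0 add.commute)

lemma cinner_diff_left: "cinner (x - z) y = cinner x y - cinner z (y :: 'a::chilbert_space)"
  using cinner_add_left [of x "-z" y] by (simp add: cinner_minus_left)

lemma cinner_add_right: "cinner x (y + z) = cinner x y + cinner x (z :: 'a::chilbert_space)"
  by (metis cinner_commute cinner_add_left complex_cnj_add)

lemma cinner_diff_right: "cinner x (y - z) = cinner x y - cinner x (z :: 'a::chilbert_space)"
  by (metis cinner_commute cinner_diff_left complex_cnj_diff)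

lemma cinner_scaleC_right: "cinner x (scaleC a y) = cnj a * cinner x (y :: 'a::chilbert_space)"
  by (metis cinner_commute cinner_scaleC_left complex_cnj_mult)

lemma cinner_sum_left:
  "cinner (\<Sum>i\<in>A. f i) (y :: 'a::chilbert_space) = (\<Sum>i\<in>A. cinner (f i) y)"
  by (induction A rule: infinite_finite_induct) (simp_all add: cinner_add_left)

lemma cinner_sum_right:
  "cinner (y :: 'a::chilbert_space) (\<Sum>i\<in>A. f i) = (\<Sum>i\<in>A. cinner y (f i))"
  by (induction A rule: infinite_finite_induct) (simp_all add: cinner_add_right)

lemma Re_cinner_commute: "Re (cinner x y) = Re (cinner y (x :: 'a::chilbert_space))"
  using cinner_commute [of x y] by simp

lemma hnorm_sq: "(hnorm x)\<^sup>2 = Re (cinner x (x :: 'a::chilbert_space))"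
  by (simp add: hnorm_def cinner_nonneg)

lemma cinner_self: "cinner x x = complex_of_real ((hnorm (x :: 'a::chilbert_space))\<^sup>2)"
  by (simp add: hnorm_sq complex_eq_iff cinner_nonneg)

lemma hnorm_ge_0 [simp]: "0 \<le> hnorm (x :: 'a::chilbert_space)"
  by (simp add: hnorm_def cinner_nonneg)

lemma hnorm_zero [simp]: "hnorm (0 :: 'a::chilbert_space) = 0"
  by (simp add: hnorm_def)

lemma hnorm_eq_0_iff [simp]: "hnorm (x :: 'a::chilbert_space) = 0 \<longleftrightarrow> x = 0"
  using cinner_eq_zero [of x] by (auto simp: cinner_self)

lemma hnorm_scaleC: "hnorm (scaleC a x) = cmod a * hnorm (x :: 'a::chilbert_space)"
proof -
  have "cinner (scaleC a x) (scaleC a x) = (a * cnj a) * cinner x x"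
    by (simp add: cinner_scaleC_left cinner_scaleC_right)
  also have "\<dots> = complex_of_real ((cmod a * hnorm x)\<^sup>2)"
    by (simp add: cinner_self complex_norm_square [symmetric] power_mult_distrib)
  finally have "(hnorm (scaleC a x))\<^sup>2 = (cmod a * hnorm x)\<^sup>2"
    by (simp only: hnorm_sq Re_complex_of_real)
  then show ?thesis by (simp add: power2_eq_iff_nonneg)
qed

lemma hnorm_minus [simp]: "hnorm (- x) = hnorm (x :: 'a::chilbert_space)"
  using hnorm_scaleC [of "-1" x] by simp

lemma hnorm_minus_commute: "hnorm (x - y) = hnorm (y - (x :: 'a::chilbert_space))"
  using hnorm_minus [of "x - y"] by simp

lemma hnorm_add_sq:
  "(hnorm (x + y))\<^sup>2 = (hnorm x)\<^sup>2 + 2 * Re (cinner x y) + (hnorm (y :: 'a::chilbert_space))\<^sup>2"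
  by (simp add: hnorm_sq cinner_add_left cinner_add_right Re_cinner_commute [of y x])

text \<open>With s = \<open>hnorm x\<close> and t = \<open>hnorm y\<close>, the squared norm of t x
  - s y equals 2 s t (s t - Re <x, y>). It is nonnegative, and for nonzero vectors the factor 2 s t
  can be cancelled.\<close>

lemma Re_cinner_le: "Re (cinner x y) \<le> hnorm x * hnorm (y :: 'a::chilbert_space)"
proof (cases "x = 0 \<or> y = 0")
  case False
  then have pos: "0 < hnorm x" "0 < hnorm y"
    by (simp_all add: order_less_le eq_commute [of 0])
  let ?s = "hnorm x" and ?t = "hnorm y"
  have "0 \<le> (hnorm (scaleC (of_real ?t) x + scaleC (of_real (- ?s)) y))\<^sup>2" by simp
  also have "\<dots> = ?t\<^sup>2 * ?s\<^sup>2 - 2 * ?t * ?s * Re (cinner x y) + ?s\<^sup>2 * ?t\<^sup>2"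
    by (simp add: hnorm_add_sq hnorm_scaleC cinner_scaleC_left cinner_scaleC_right
        power_mult_distrib del: of_real_minus)
  also have "\<dots> = 2 * (?s * ?t) * (?s * ?t - Re (cinner x y))"
    by (simp add: power2_eq_square algebra_simps)
  finally show ?thesis using pos by (metis diff_ge_0_iff_ge mult_pos_pos zero_le_mult_iff not_less zero_less_numeral)
qed auto

lemma cmod_cinner_le: "cmod (cinner x y) \<le> hnorm x * hnorm (y :: 'a::chilbert_space)"
proof (cases "cinner x y = 0")
  case False
  \<comment> \<open>This phase has modulus one and turns the inner product into its modulus, so the
    bound on real parts applies.\<close>
  let ?c = "cnj (sgn (cinner x y))"
  have "cinner (scaleC ?c x) y = of_real (cmod (cinner x y))"
    by (simp add: cinner_scaleC_left sgn_eq complex_norm_square [symmetric] power2_eq_square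
        field_simps False flip: of_real_mult)
  then have "cmod (cinner x y) \<le> hnorm (scaleC ?c x) * hnorm y"
    using Re_cinner_le [of "scaleC ?c x" y] by simp
  then show ?thesis by (simp add: hnorm_scaleC norm_sgn False)
qed simp

lemma hnorm_triangle: "hnorm (x + y) \<le> hnorm x + hnorm (y :: 'a::chilbert_space)"
proof (rule power2_le_imp_le)
  show "(hnorm (x + y))\<^sup>2 \<le> (hnorm x + hnorm y)\<^sup>2"
    using Re_cinner_le [of x y] by (simp add: hnorm_add_sq power2_sum)
qed simp

lemma hnorm_triangle_diff: "hnorm (x - y) \<le> hnorm x + hnorm (y :: 'a::chilbert_space)"
  using hnorm_triangle [of x "-y"] by simp

lemma hnorm_triangle_mid: "hnorm (x - z) \<le> hnorm (x - y) + hnorm (y - (z :: 'a::chilbert_space))"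
  using hnorm_triangle [of "x - y" "y - z"] by simp

lemma hnorm_sum_le: "hnorm (\<Sum>i\<in>A. f i :: 'a::chilbert_space) \<le> (\<Sum>i\<in>A. hnorm (f i))"
  by (induction A rule: infinite_finite_induct)
    (auto intro: order_trans [OF hnorm_triangle])

section \<open>Norm convergence of sequences of vectors\<close>

text \<open>The class \<open>chilbert_space\<close> carries no topology, so convergence of vectors
  is reduced to that of a real sequence.\<close>

definition hlim :: "(nat \<Rightarrow> 'a::chilbert_space) \<Rightarrow> 'a \<Rightarrow> bool" where
  "hlim f L \<longleftrightarrow> (\<lambda>n. hnorm (f n - L)) \<longlonglongrightarrow> 0"

text \<open>Symmetry of the distance makes a tail bound for n \<le> m sufficient. Completeness of
  the space enters the development here only.\<close>

lemma hlim_Cauchy: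
  fixes f :: "nat \<Rightarrow> 'a::chilbert_space"
  assumes "\<And>m n. n \<le> m \<Longrightarrow> hnorm (f m - f n) \<le> r n" and "r \<longlonglongrightarrow> 0"
  obtains L where "hlim f L"
proof -
  have "\<exists>N. \<forall>m\<ge>N. \<forall>n\<ge>N. hnorm (f m - f n) < e" if "0 < e" for e
  proof -
    obtain N where N: "\<And>n. n \<ge> N \<Longrightarrow> r n < e"
      using order_tendstoD(2) [OF assms(2) \<open>0 < e\<close>] by (auto simp: eventually_sequentially)
    have "hnorm (f m - f n) < e" if "m \<ge> N" "n \<ge> N" for m n
    proof (cases "n \<le> m")
      case True
      then show ?thesis using assms(1) [of n m] N [of n] that by simp
    next
      case False
      then show ?thesis using assms(1) [of m n] N [of m] that hnorm_minus_commute [of "f m"] by simp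
    qed
    then show ?thesis by blast
  qed
  then show ?thesis
    using hilbert_complete [of f] that by (auto simp: hlim_def hnorm_def)
qed

lemma hlim_unique:
  assumes "hlim f L" "hlim f M" shows "L = M"
proof -
  have "(\<lambda>n. hnorm (f n - L) + hnorm (f n - M)) \<longlonglongrightarrow> 0 + 0"
    using assms unfolding hlim_def by (rule tendsto_add)
  moreover have "hnorm (L - M) \<le> hnorm (f n - L) + hnorm (f n - M)" for n
    using hnorm_triangle_mid [of L M "f n"] by (simp add: hnorm_minus_commute [of L])
  ultimately have "hnorm (L - M) \<le> 0"
    by (intro LIMSEQ_le_const [of _ "0::real"]) auto
  then show ?thesis
    using hnorm_ge_0 [of "L - M"] by (metis antisym hnorm_eq_0_iff right_minus_eq)
qed

lemma hlim_zeroI: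
  assumes "\<And>n. hnorm (f n - L) \<le> g n" and "g \<longlonglongrightarrow> 0"
  shows "hlim f L"
  unfolding hlim_def
  by (rule tendsto_sandwich [OF _ _ tendsto_const assms(2)]) (auto simp: assms(1))

lemma hlim_const: "hlim (\<lambda>_. x) x"
  by (simp add: hlim_def)

lemma hlim_add: assumes "hlim f L" "hlim g M" shows "hlim (\<lambda>n. f n + g n) (L + M)"
proof (rule hlim_zeroI)
  show "hnorm (f n + g n - (L + M)) \<le> hnorm (f n - L) + hnorm (g n - M)" for n
    using hnorm_triangle [of "f n - L" "g n - M"] by (simp add: algebra_simps)
  show "(\<lambda>n. hnorm (f n - L) + hnorm (g n - M)) \<longlonglongrightarrow> 0"
    using tendsto_add [OF assms [unfolded hlim_def]] by simp
qed

lemma hlim_scaleC: assumes "hlim f L" shows "hlim (\<lambda>n. scaleC a (f n)) (scaleC a L)"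
proof (rule hlim_zeroI)
  show "hnorm (scaleC a (f n) - scaleC a L) \<le> cmod a * hnorm (f n - L)" for n
    by (simp add: hnorm_scaleC flip: scaleC_diff_right)
  show "(\<lambda>n. cmod a * hnorm (f n - L)) \<longlonglongrightarrow> 0"
    using tendsto_mult_right_zero assms [unfolded hlim_def] by blast
qed

lemma hlim_minus: "hlim f L \<Longrightarrow> hlim (\<lambda>n. - f n) (- L)"
  using hlim_scaleC [of f L "-1"] by simp

lemma hlim_diff: "hlim f L \<Longrightarrow> hlim g M \<Longrightarrow> hlim (\<lambda>n. f n - g n) (L - M)"
  using hlim_add [OF _ hlim_minus] by fastforce

lemma hlim_cinner_left: assumes "hlim f L" shows "(\<lambda>n. cinner (f n) y) \<longlonglongrightarrow> cinner L y"
proof (rule LIM_zero_cancel, rule tendsto_norm_zero_cancel)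
  have "(\<lambda>n. hnorm (f n - L) * hnorm y) \<longlonglongrightarrow> 0"
    using tendsto_mult_left_zero assms [unfolded hlim_def] by blast
  then show "(\<lambda>n. cmod (cinner (f n) y - cinner L y)) \<longlonglongrightarrow> 0"
    by (rule tendsto_sandwich [OF _ _ tendsto_const, rotated -1])
      (auto simp: cmod_cinner_le simp flip: cinner_diff_left)
qed

lemma hlim_cinner_right: assumes "hlim f L" shows "(\<lambda>n. cinner y (f n)) \<longlonglongrightarrow> cinner y L"
  using tendsto_cnj [OF hlim_cinner_left [OF assms, of y]] by (simp add: cinner_commute [symmetric])

lemma hlim_hnorm: assumes "hlim f L" shows "(\<lambda>n. hnorm (f n)) \<longlonglongrightarrow> hnorm L"
proof (rule LIM_zero_cancel, rule tendsto_rabs_zero_cancel)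
  have "\<bar>hnorm (f n) - hnorm L\<bar> \<le> hnorm (f n - L)" for n
    using hnorm_triangle [of "f n - L" L] hnorm_triangle [of "L - f n" "f n"]
    by (simp add: hnorm_minus_commute [of L])
  then show "(\<lambda>n. \<bar>hnorm (f n) - hnorm L\<bar>) \<longlonglongrightarrow> 0"
    by (intro tendsto_sandwich [OF _ _ tendsto_const assms [unfolded hlim_def]]) auto
qed

section \<open>Bounded operators\<close>

lemma bounded_op_add: "bounded_op T \<Longrightarrow> T (x + y) = T x + T y"
  by (simp add: bounded_op_def)

lemma bounded_op_scaleC: "bounded_op T \<Longrightarrow> T (scaleC a x) = scaleC a (T x)"
  by (simp add: bounded_op_def)

lemma bounded_op_diff: "bounded_op T \<Longrightarrow> T (x - y) = T x - T y"
  using bounded_op_add [of T "x - y" y] by (simp add: algebra_simps)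

lemma bounded_op_bound:
  assumes "bounded_op T"
  obtains K where "0 < K" "\<And>x. hnorm (T x) \<le> K * hnorm x"
proof -
  obtain K where K: "\<And>x. hnorm (T x) \<le> K * hnorm x" using assms by (auto simp: bounded_op_def)
  show ?thesis
  proof (rule that)
    show "hnorm (T x) \<le> (\<bar>K\<bar> + 1) * hnorm x" for x
      by (rule order_trans [OF K]) (simp add: mult_right_mono)
  qed simp
qed

lemma hlim_bounded_op: assumes "bounded_op T" "hlim f L" shows "hlim (\<lambda>n. T (f n)) (T L)"
proof -
  obtain K where K: "\<And>x. hnorm (T x) \<le> K * hnorm x" using assms(1) bounded_op_bound by blast
  show ?thesis
  proof (rule hlim_zeroI)
    show "hnorm (T (f n) - T L) \<le> K * hnorm (f n - L)" for n
      using K [of "f n - L"] by (simp add: bounded_op_diff [OF assms(1)])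
    show "(\<lambda>n. K * hnorm (f n - L)) \<longlonglongrightarrow> 0"
      using tendsto_mult_right_zero assms(2) [unfolded hlim_def] by blast
  qed
qed

section \<open>Norm limits and norm-convergent series of operators\<close>

text \<open>The rate \<open>r n\<close> does not depend on x. Letting m tend to infinity in
  \<open>cauchy\<close> therefore shows that the pointwise limit is a limit in operator norm;
  comparison with \<open>A 0\<close> bounds it.\<close>

lemma norm_closed_limit:
  assumes I: "norm_closed I" and mem: "\<And>n. A n \<in> I" and bd: "\<And>n. bounded_op (A n)"
    and cauchy: "\<And>m n x. n \<le> m \<Longrightarrow> hnorm (A m x - A n x) \<le> r n * hnorm x"
    and r: "r \<longlonglongrightarrow> (0::real)"
  obtains B where "B \<in> I" "bounded_op B" "\<And>x. hlim (\<lambda>n. A n x) (B x)"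
proof -
  have "\<exists>L. hlim (\<lambda>n. A n x) L" for x
  proof (rule hlim_Cauchy)
    show "hnorm (A m x - A n x) \<le> r n * hnorm x" if "n \<le> m" for m n by (rule cauchy [OF that])
    show "(\<lambda>n. r n * hnorm x) \<longlonglongrightarrow> 0" using r tendsto_mult_left_zero by blast
  qed blast
  then obtain B where B: "\<And>x. hlim (\<lambda>n. A n x) (B x)" by metis
  have close: "hnorm (B x - A n x) \<le> r n * hnorm x" for x n
    by (rule LIMSEQ_le_const2 [OF hlim_hnorm [OF hlim_diff [OF B hlim_const]]])
      (use cauchy in blast)
  obtain K where K: "\<And>x. hnorm (A 0 x) \<le> K * hnorm x" using bd bounded_op_bound by blast
  have "bounded_op B"
    unfolding bounded_op_def
  proof (intro conjI allI exI)
    show "B (x + y) = B x + B y" for x y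
      by (rule hlim_unique [OF B]) (use hlim_add [OF B B] in \<open>simp add: bounded_op_add [OF bd]\<close>)
    show "B (scaleC a x) = scaleC a (B x)" for a x
      by (rule hlim_unique [OF B]) (use hlim_scaleC [OF B] in \<open>simp add: bounded_op_scaleC [OF bd]\<close>)
    show "hnorm (B x) \<le> (r 0 + K) * hnorm x" for x
      using hnorm_triangle [of "B x - A 0 x" "A 0 x"] close [of x 0] K [of x]
      by (simp add: algebra_simps)
  qed
  moreover have "\<exists>C\<in>I. \<forall>x. hnorm (B x - C x) \<le> e * hnorm x" if "0 < e" for e
  proof -
    obtain n where "r n < e"
      using order_tendstoD(2) [OF r \<open>0 < e\<close>] by (auto simp: eventually_sequentially)
    then have "hnorm (B x - A n x) \<le> e * hnorm x" for x
      by (intro order_trans [OF close] mult_right_mono) auto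
    then show ?thesis using mem by blast
  qed
  ultimately have "B \<in> I" using I by (simp add: norm_closed_def)
  then show ?thesis using that B \<open>bounded_op B\<close> by blast
qed

text \<open>The weights 1/2, 1/4, ... sum to 1. Hence the partial sums converge at a geometric rate,
  and the tail estimate from n = 0 makes the sum a contraction, which later yields H \<le>
  1.\<close>

lemma norm_closed_series:
  assumes I: "norm_closed I" and bdI: "\<And>A. A \<in> I \<Longrightarrow> bounded_op A"
    and zero: "(\<lambda>_. 0) \<in> I" and add: "\<And>A B. A \<in> I \<Longrightarrow> B \<in> I \<Longrightarrow> (\<lambda>x. A x + B x) \<in> I"
    and mem: "\<And>k. D k \<in> I" and bound: "\<And>k x. hnorm (D k x) \<le> (1/2) ^ Suc k * hnorm x"
  obtains B where "B \<in> I" "bounded_op B" "\<And>x. hlim (\<lambda>n. \<Sum>k<n. D k x) (B x)"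
    "\<And>x. hnorm (B x) \<le> hnorm x"
proof -
  let ?S = "\<lambda>n x. \<Sum>k<n. D k x"
  have S: "?S n \<in> I" for n
    by (induction n) (simp_all add: zero add mem)
  have tail: "hnorm (?S m x - ?S n x) \<le> (1/2) ^ n * hnorm x" if "n \<le> m" for m n x
  proof -
    have "?S m x - ?S n x = (\<Sum>k=n..<m. D k x)"
      using sum_diff_nat_ivl [of 0 n m "\<lambda>k. D k x"] that by (simp add: lessThan_atLeast0)
    then have "hnorm (?S m x - ?S n x) \<le> (\<Sum>k=n..<m. (1/2) ^ Suc k * hnorm x)"
      by (metis (no_types, lifting) order_trans hnorm_sum_le sum_mono bound)
    also have "\<dots> = ((1/2) ^ n - (1/2) ^ m) * hnorm x"
      using that by (induction rule: dec_induct) (simp_all add: algebra_simps)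
    also have "\<dots> \<le> (1/2) ^ n * hnorm x" by (simp add: mult_right_mono)
    finally show ?thesis .
  qed
  obtain B where B: "B \<in> I" "bounded_op B" "\<And>x. hlim (\<lambda>n. ?S n x) (B x)"
  proof (rule norm_closed_limit [OF I S bdI [OF S] tail])
    show "(\<lambda>n. (1/2) ^ n) \<longlonglongrightarrow> (0::real)" by (rule LIMSEQ_realpow_zero) auto
  qed auto
  have "hnorm (B x) \<le> hnorm x" for x
    by (rule LIMSEQ_le_const2 [OF hlim_hnorm [OF B(3)]]) (use tail [of 0 _ x] in auto)
  then show ?thesis using that B by blast
qed

section \<open>Powers of a positive contraction\<close>

locale positive_contraction =
  fixes X :: "'a::chilbert_space \<Rightarrow> 'a"
  assumes bounded: "bounded_op X"
    and sym: "cinner (X x) y = cinner x (X y)"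
    and nonneg: "0 \<le> Re (cinner (X x) x)"
    and le_id: "Re (cinner (X x) x) \<le> Re (cinner x x)"
begin

text \<open>In spectral terms this is the integral of t^n against a measure on [0,1] of total mass
  |x|^2. The properties suggested by that picture are derived below by algebra alone.\<close>

definition moment :: "nat \<Rightarrow> 'a \<Rightarrow> real" where
  "moment n x = Re (cinner ((X ^^ n) x) x)"

lemma funpow_sym: "cinner ((X ^^ n) x) y = cinner x ((X ^^ n) y)"
  by (induction n arbitrary: x y) (simp_all add: sym funpow_swap1)

lemma Re_cinner_funpow: "Re (cinner ((X ^^ m) x) ((X ^^ n) x)) = moment (m + n) x"
  by (simp add: moment_def add.commute [of m n] funpow_add funpow_sym [of n "(X ^^ m) x"])

lemma funpow_diff: "(X ^^ n) (x - y) = (X ^^ n) x - (X ^^ n) y"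
  by (induction n) (simp_all add: bounded_op_diff [OF bounded])

text \<open>Moving half of the powers across the inner product leaves |y|^2 for even n and <X y, y>
  for odd n, where y is a power of X applied to x.\<close>

lemma moment_nonneg: "0 \<le> moment n x"
proof (cases "even n")
  case True
  then obtain m where "n = m + m" by (metis evenE mult_2)
  then have "moment n x = (hnorm ((X ^^ m) x))\<^sup>2" by (simp add: Re_cinner_funpow hnorm_sq)
  then show ?thesis by simp
next
  case False
  then obtain m where "n = Suc m + m" by (metis oddE mult_2 add_Suc Suc_eq_plus1)
  then show ?thesis using nonneg [of "(X ^^ m) x"] Re_cinner_funpow [of "Suc m" x m] by simp
qed

lemma moment_shift: "moment n ((X ^^ m) x) = moment (n + 2 * m) x"
  using Re_cinner_funpow [of "n + m" x m]
  by (simp add: moment_def [of n] funpow_add mult_2 add.assoc)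

lemma moment_diff: "moment n (x - X x) = moment n x - 2 * moment (Suc n) x + moment (Suc (Suc n)) x"
proof -
  have "moment n (x - X x) = Re (cinner ((X ^^ n) x) ((X ^^ 0) x))
      - Re (cinner ((X ^^ n) x) ((X ^^ 1) x)) - Re (cinner ((X ^^ Suc n) x) ((X ^^ 0) x))
      + Re (cinner ((X ^^ Suc n) x) ((X ^^ 1) x))"
    by (simp add: moment_def funpow_diff cinner_diff_left cinner_diff_right funpow_swap1)
  then show ?thesis unfolding Re_cinner_funpow by simp
qed

text \<open>The second difference of the moments of x is a moment of x - X x, hence
  nonnegative.\<close>

lemma moment_convex: "moment (Suc n) x - moment (Suc (Suc n)) x \<le> moment n x - moment (Suc n) x"
  using moment_nonneg [of n "x - X x"] by (simp add: moment_diff)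

text \<open>For even n this is X \<le> 1 tested on a power of X applied to x. For odd n, convexity
  bounds the decrement at n below by the one at the even index n + 1.\<close>

lemma moment_decreasing: "moment (Suc n) x \<le> moment n x"
proof -
  have le: "moment (Suc (2 * m)) x \<le> moment (2 * m) x" for m
    using le_id [of "(X ^^ m) x"] moment_shift [of 1 m x] moment_shift [of 0 m x]
    by (simp add: moment_def)
  show ?thesis
  proof (cases "even n")
    case True
    then show ?thesis using le [of "n div 2"] by simp
  next
    case False
    then show ?thesis
      using le [of "Suc (n div 2)"] moment_convex [of n x] odd_two_times_div_two_succ [of n] by simp
  qed
qed

lemma moment_le: "moment n x \<le> (hnorm x)\<^sup>2"
proof (induction n)
  case 0
  then show ?case by (simp add: moment_def hnorm_sq)
next
  case (Suc n)
  then show ?case using moment_decreasing [of n x] by simp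
qed

lemma hnorm_funpow_le: "hnorm ((X ^^ n) x) \<le> hnorm x"
  by (rule power2_le_imp_le) (simp_all add: hnorm_sq [of "(X ^^ n) x"] Re_cinner_funpow moment_le)

lemma moment_diff_decreasing:
  "n \<le> m \<Longrightarrow> moment m x - moment (Suc m) x \<le> moment n x - moment (Suc n) x"
  by (induction rule: dec_induct) (use moment_convex order_trans in blast)+

text \<open>The decrements shrink, so the last of the first n + 1 is at most their average, and
  their sum telescopes to at most |x|^2.\<close>

lemma moment_diff_le: "real (Suc n) * (moment n x - moment (Suc n) x) \<le> (hnorm x)\<^sup>2"
proof -
  have "real (Suc n) * (moment n x - moment (Suc n) x)
      \<le> (\<Sum>k<Suc n. moment k x - moment (Suc k) x)"
    using sum_bounded_below [of "{..<Suc n}" "moment n x - moment (Suc n) x"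
        "\<lambda>k. moment k x - moment (Suc k) x"] moment_diff_decreasing [of _ n x] by simp
  also have "\<dots> = moment 0 x - moment (Suc n) x" by (rule sum_lessThan_telescope')
  also have "\<dots> \<le> (hnorm x)\<^sup>2" using moment_nonneg [of "Suc n" x] moment_le [of 0 x] by simp
  finally show ?thesis .
qed

section \<open>The defects x - X^m x and the convergence of the powers\<close>

text \<open>Spectrally the integrand is (1 - t^m)(1 - t^n) \<ge> 0. In moments the claim says that m
  steps starting at n lose no more than m steps starting at 0, which follows from convexity.\<close>

lemma Re_cinner_defect_nonneg: "0 \<le> Re (cinner (x - (X ^^ m) x) (x - (X ^^ n) x))"
proof -
  have "moment n x - moment (n + m) x \<le> moment 0 x - moment m x"
  proof (induction m)
    case (Suc m)
    then show ?case using moment_diff_decreasing [of m "n + m" x] by simp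
  qed simp
  moreover have "Re (cinner (x - (X ^^ m) x) (x - (X ^^ n) x))
      = moment 0 x - moment n x - moment m x + moment (m + n) x"
    using Re_cinner_funpow [of 0 x 0] Re_cinner_funpow [of 0 x n] Re_cinner_funpow [of m x 0]
    by (simp add: cinner_diff_left cinner_diff_right Re_cinner_funpow)
  ultimately show ?thesis by (simp add: add.commute)
qed

text \<open>All cross terms in the expanded square are nonnegative, so the remaining summands cannot
  cancel the k-th one.\<close>

lemma hnorm_sum_defect_ge:
  fixes k n :: nat
  assumes "k < n" and "\<And>j. 0 \<le> w j"
  shows "hnorm (scaleC (of_real (w k)) (x - (X ^^ m k) x))
    \<le> hnorm (\<Sum>j<n. scaleC (of_real (w j)) (x - (X ^^ m j) x))"
proof (rule power2_le_imp_le)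
  define d where "d j = scaleC (complex_of_real (w j)) (x - (X ^^ m j) x)" for j
  have cross: "0 \<le> Re (cinner (d i) (d j))" for i j
    using Re_cinner_defect_nonneg [of x "m i" "m j"] assms(2)
    by (simp add: d_def cinner_scaleC_left cinner_scaleC_right)
  have "(\<Sum>j<n. d j) = d k + (\<Sum>j\<in>{..<n} - {k}. d j)"
    using assms(1) by (intro sum.remove) auto
  moreover have "0 \<le> Re (cinner (d k) (\<Sum>j\<in>{..<n} - {k}. d j))"
    unfolding cinner_sum_right Re_sum by (intro sum_nonneg cross)
  ultimately have "(hnorm (d k))\<^sup>2 \<le> (hnorm (\<Sum>j<n. d j))\<^sup>2"
    by (simp add: hnorm_add_sq)
  then show "(hnorm (scaleC (of_real (w k)) (x - (X ^^ m k) x)))\<^sup>2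
    \<le> (hnorm (\<Sum>j<n. scaleC (of_real (w j)) (x - (X ^^ m j) x)))\<^sup>2"
    by (simp add: d_def)
qed simp

text \<open>Applying the hypothesis to \<open>(X ^^ n) x\<close> bounds the left side by \<open>c\<close> times the
  increment \<open>moment (2 * n) x - moment (2 * n + 1) x\<close> of a convex bounded sequence.\<close>
lemma funpow_Cauchy:
  assumes "0 \<le> c" and gap: "\<And>m x. (hnorm (x - (X ^^ m) x))\<^sup>2 \<le> c * Re (cinner (x - X x) x)"
    and "n \<le> m"
  shows "hnorm ((X ^^ n) x - (X ^^ m) x) \<le> sqrt (c / real (Suc n)) * hnorm x"
proof -
  let ?y = "(X ^^ n) x"
  have "(X ^^ m) x = (X ^^ (m - n)) ?y"
    using assms(3) by (metis funpow_add comp_apply le_add_diff_inverse2)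
  then have "(hnorm (?y - (X ^^ m) x))\<^sup>2 \<le> c * Re (cinner (?y - X ?y) ?y)"
    using gap [of ?y "m - n"] by simp
  also have "Re (cinner (?y - X ?y) ?y) = moment (2 * n) x - moment (Suc (2 * n)) x"
    using moment_shift [of 0 n x] moment_shift [of 1 n x] by (simp add: cinner_diff_left moment_def)
  also have "c * \<dots> \<le> c * ((hnorm x)\<^sup>2 / real (Suc n))"
  proof (rule mult_left_mono [OF _ \<open>0 \<le> c\<close>])
    \<comment> \<open>\<open>moment_diff_le\<close> at index 2n offers the factor 2n + 1; it is
      weakened to n + 1 to get a simpler rate.\<close>
    have "real (Suc n) * (moment (2 * n) x - moment (Suc (2 * n)) x)
        \<le> real (Suc (2 * n)) * (moment (2 * n) x - moment (Suc (2 * n)) x)"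
      by (rule mult_right_mono) (use moment_decreasing [of "2 * n" x] in auto)
    then show "moment (2 * n) x - moment (Suc (2 * n)) x \<le> (hnorm x)\<^sup>2 / real (Suc n)"
      using moment_diff_le [of "2 * n" x] by (simp add: pos_le_divide_eq mult.commute)
  qed
  also have "\<dots> = (sqrt (c / real (Suc n)) * hnorm x)\<^sup>2"
    using \<open>0 \<le> c\<close> unfolding power_mult_distrib by (subst real_sqrt_pow2) auto
  finally show ?thesis
    by (rule power2_le_imp_le) (use \<open>0 \<le> c\<close> in simp)
qed

end

section \<open>Closed left ideals\<close>

lemma is_adjoint_limit:
  assumes "\<And>n. is_adjoint (A n) (A n)" and "\<And>x. hlim (\<lambda>n. A n x) (B x)"
  shows "is_adjoint B B"
  unfolding is_adjoint_def
proof (intro allI)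
  fix x y
  show "cinner (B x) y = cinner x (B y)"
  proof (rule LIMSEQ_unique)
    show "(\<lambda>n. cinner (A n x) y) \<longlonglongrightarrow> cinner (B x) y" by (rule hlim_cinner_left [OF assms(2)])
    show "(\<lambda>n. cinner (A n x) y) \<longlonglongrightarrow> cinner x (B y)"
      using hlim_cinner_right [OF assms(2), of x y] assms(1) by (simp add: is_adjoint_def)
  qed
qed

locale closed_left_ideal =
  fixes R I :: "('a::chilbert_space \<Rightarrow> 'a) set"
  assumes vn: "von_neumann_algebra R" and ideal: "left_ideal R I" and closed: "norm_closed I"
begin

lemma R_bounded: "A \<in> R \<Longrightarrow> bounded_op A" using vn by (simp add: von_neumann_algebra_def)
lemma R_id: "id \<in> R" using vn by (simp add: von_neumann_algebra_def)
lemma R_add: "A \<in> R \<Longrightarrow> B \<in> R \<Longrightarrow> (\<lambda>x. A x + B x) \<in> R"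
  using vn by (simp add: von_neumann_algebra_def)
lemma R_scaleC: "A \<in> R \<Longrightarrow> (\<lambda>x. scaleC a (A x)) \<in> R"
  using vn by (simp add: von_neumann_algebra_def)
lemma R_comp: "A \<in> R \<Longrightarrow> B \<in> R \<Longrightarrow> A \<circ> B \<in> R"
  using vn by (simp add: von_neumann_algebra_def)
lemma R_adjoint: "A \<in> R \<Longrightarrow> \<exists>B\<in>R. is_adjoint A B"
  using vn by (simp add: von_neumann_algebra_def)

lemma I_subset: "A \<in> I \<Longrightarrow> A \<in> R" using ideal by (auto simp: left_ideal_def)
lemma I_zero: "(\<lambda>_. 0) \<in> I" using ideal by (simp add: left_ideal_def)
lemma I_add: "A \<in> I \<Longrightarrow> B \<in> I \<Longrightarrow> (\<lambda>x. A x + B x) \<in> I" using ideal by (simp add: left_ideal_def)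
lemma I_scaleC: "A \<in> I \<Longrightarrow> (\<lambda>x. scaleC a (A x)) \<in> I" using ideal by (simp add: left_ideal_def)
lemma I_comp: "A \<in> R \<Longrightarrow> B \<in> I \<Longrightarrow> A \<circ> B \<in> I" using ideal by (simp add: left_ideal_def)
lemma I_bounded: "A \<in> I \<Longrightarrow> bounded_op A" by (simp add: R_bounded I_subset)

lemma series:
  assumes "\<And>k. D k \<in> I" and "\<And>k x. hnorm (D k x) \<le> (1/2) ^ Suc k * hnorm x"
  obtains B where "B \<in> I" "\<And>x. hlim (\<lambda>n. \<Sum>k<n. D k x) (B x)" "\<And>x. hnorm (B x) \<le> hnorm x"
  by (rule norm_closed_series [OF closed _ I_zero _ assms]) (simp_all add: I_bounded I_add)

section \<open>Domination of the ideal by one quadratic form\<close>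

text \<open><H x, x> is the sum of the nonnegative numbers w_k |T_k x|^2, so it bounds each of them;
  the constant for T_k is 1 / w_k.\<close>

lemma dominating_element:
  fixes T :: "nat \<Rightarrow> 'a \<Rightarrow> 'a"
  assumes T: "\<And>k. T k \<in> I"
  obtains H where "H \<in> I" "is_adjoint H H"
    "\<forall>x. 0 \<le> Re (cinner (H x) x)" "\<forall>x. Re (cinner (H x) x) \<le> Re (cinner x x)"
    "\<forall>k. \<exists>c. \<forall>x. (hnorm (T k x))\<^sup>2 \<le> c * Re (cinner (H x) x)"
proof -
  obtain B where B: "\<And>k. B k \<in> R" "\<And>k. is_adjoint (T k) (B k)"
    using R_adjoint [OF I_subset [OF T]] by metis
  \<comment> \<open>The adjoint is known to lie in R only, but multiplying T_k by it on the left
    stays in the left ideal.\<close>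
  have BT: "B k \<circ> T k \<in> I" for k by (rule I_comp [OF B(1) T])
  have "\<exists>K>0. \<forall>x. hnorm (B k (T k x)) \<le> K * hnorm x" for k
    using bounded_op_bound [OF I_bounded [OF BT [of k]]] by (metis comp_apply)
  then obtain K where K: "\<And>k. 0 < K k" "\<And>k x. hnorm (B k (T k x)) \<le> K k * hnorm x" by metis
  \<comment> \<open>Dividing by the bound \<open>K k\<close> gives the k-th summand norm at most
    2^-(k+1), as \<open>series\<close> requires.\<close>
  define w where "w k = (1/2) ^ Suc k / K k" for k
  have w: "0 < w k" for k using K(1) by (simp add: w_def)
  define D where "D k x = scaleC (complex_of_real (w k)) ((B k \<circ> T k) x)" for k x
  have D: "D k \<in> I" for k unfolding D_def by (rule I_scaleC [OF BT])
  have D_bound: "hnorm (D k x) \<le> (1/2) ^ Suc k * hnorm x" for k x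
  proof -
    have "hnorm (D k x) = w k * hnorm (B k (T k x))"
      by (simp add: D_def hnorm_scaleC less_imp_le [OF w])
    also have "\<dots> \<le> w k * (K k * hnorm x)"
      by (rule mult_left_mono [OF K(2) less_imp_le [OF w]])
    also have "\<dots> = (1/2) ^ Suc k * hnorm x" using K(1) [of k] by (simp add: w_def)
    finally show ?thesis .
  qed
  have TT: "cinner (T k x) (T k y) = cinner x (B k (T k y))" for k x y
    using B(2) [of k] by (simp add: is_adjoint_def)
  have TT': "cinner (B k (T k x)) y = cinner (T k x) (T k y)" for k x y
    using TT [of k y x] by (metis cinner_commute)
  have D_adj: "is_adjoint (D k) (D k)" for k
    by (simp add: is_adjoint_def D_def cinner_scaleC_left cinner_scaleC_right TT' TT)
  have D_Re: "Re (cinner (D k x) x) = w k * (hnorm (T k x))\<^sup>2" for k x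
    by (simp add: D_def cinner_scaleC_left TT' hnorm_sq)
  obtain H where H: "H \<in> I" "\<And>x. hlim (\<lambda>n. \<Sum>k<n. D k x) (H x)" "\<And>x. hnorm (H x) \<le> hnorm x"
    by (rule series [of D, OF D D_bound]) blast
  have ge: "w k * (hnorm (T k x))\<^sup>2 \<le> Re (cinner (H x) x)" for k x
  proof (rule LIMSEQ_le_const [OF tendsto_Re [OF hlim_cinner_left [OF H(2)]]])
    have "w k * (hnorm (T k x))\<^sup>2 \<le> Re (cinner (\<Sum>k<n. D k x) x)" if "Suc k \<le> n" for n
      unfolding cinner_sum_left Re_sum D_Re
      by (rule member_le_sum) (use that w in \<open>auto simp: less_imp_le\<close>)
    then show "\<exists>N. \<forall>n\<ge>N. w k * (hnorm (T k x))\<^sup>2 \<le> Re (cinner (\<Sum>k<n. D k x) x)" by blast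
  qed
  have "is_adjoint H H"
  proof (rule is_adjoint_limit [OF _ H(2)])
    show "is_adjoint (\<lambda>x. \<Sum>k<n. D k x) (\<lambda>x. \<Sum>k<n. D k x)" for n
      using D_adj by (simp add: is_adjoint_def cinner_sum_left cinner_sum_right)
  qed
  show ?thesis
  proof (rule that [OF H(1) \<open>is_adjoint H H\<close>]; intro allI)
    show "0 \<le> Re (cinner (H x) x)" for x
      by (rule order_trans [OF _ ge [of 0]]) (simp add: less_imp_le [OF w])
    show "Re (cinner (H x) x) \<le> Re (cinner x x)" for x
      using order_trans [OF Re_cinner_le mult_right_mono [OF H(3) hnorm_ge_0], of x x]
      by (simp add: hnorm_sq [symmetric] power2_eq_square)
    show "\<exists>c. \<forall>x. (hnorm (T k x))\<^sup>2 \<le> c * Re (cinner (H x) x)" for k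
      using ge [of k] w [of k] by (intro exI [of _ "1 / w k"]) (simp add: field_simps)
  qed
qed

text \<open>This carries domination from the generators to the whole generated ideal. Since the
  constant may depend on A, it can double under sums and grow by K^2 under left multiplication by an
  operator with bound K.\<close>

lemma dominated_left_ideal:
  "left_ideal R {A \<in> R. \<exists>c. \<forall>x. (hnorm (A x))\<^sup>2 \<le> c * (h x :: real)}"
  unfolding left_ideal_def
proof (intro conjI ballI allI)
  let ?J = "{A \<in> R. \<exists>c. \<forall>x. (hnorm (A x))\<^sup>2 \<le> c * h x}"
  show "?J \<subseteq> R" by blast
  show "(\<lambda>_. 0) \<in> ?J" by (auto intro: I_subset I_zero exI [of _ 0])
  fix A B assume "B \<in> ?J"
  then obtain c where B: "B \<in> R" and c: "\<And>x. (hnorm (B x))\<^sup>2 \<le> c * h x" by auto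
  show "(\<lambda>x. A x + B x) \<in> ?J" if AJ: "A \<in> ?J"
  proof -
    obtain d where A: "A \<in> R" and d: "\<And>x. (hnorm (A x))\<^sup>2 \<le> d * h x" using AJ by auto
    have "(hnorm (A x + B x))\<^sup>2 \<le> (2 * d + 2 * c) * h x" for x
    proof -
      have "(hnorm (A x + B x))\<^sup>2 \<le> (hnorm (A x) + hnorm (B x))\<^sup>2"
        by (rule power_mono [OF hnorm_triangle]) simp
      also have "\<dots> \<le> 2 * (hnorm (A x))\<^sup>2 + 2 * (hnorm (B x))\<^sup>2"
        using sum_squares_bound [of "hnorm (A x)" "hnorm (B x)"] by (simp add: power2_sum)
      finally show ?thesis using c [of x] d [of x] by (simp add: algebra_simps)
    qed
    then show ?thesis using R_add [OF A B] by blast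
  qed
  show "A \<circ> B \<in> ?J" if AR: "A \<in> R"
  proof -
    obtain K where K: "0 < K" "\<And>x. hnorm (A x) \<le> K * hnorm x"
      using bounded_op_bound [OF R_bounded [OF AR]] by blast
    have "(hnorm ((A \<circ> B) x))\<^sup>2 \<le> (K\<^sup>2 * c) * h x" for x
    proof -
      have "(hnorm ((A \<circ> B) x))\<^sup>2 \<le> (K * hnorm (B x))\<^sup>2"
        by (rule power_mono) (use K in auto)
      also have "\<dots> \<le> K\<^sup>2 * (c * h x)"
        unfolding power_mult_distrib by (rule mult_left_mono [OF c]) simp
      finally show ?thesis by (simp add: mult.assoc)
    qed
    then show ?thesis using R_comp [OF AR B] by blast
  qed
next
  let ?J = "{A \<in> R. \<exists>c. \<forall>x. (hnorm (A x))\<^sup>2 \<le> c * h x}"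
  fix B a assume "B \<in> ?J"
  then obtain c where B: "B \<in> R" and c: "\<And>x. (hnorm (B x))\<^sup>2 \<le> c * h x" by auto
  have "(hnorm (scaleC a (B x)))\<^sup>2 \<le> ((cmod a)\<^sup>2 * c) * h x" for x
    using mult_left_mono [OF c [of x], of "(cmod a)\<^sup>2"]
    by (simp add: hnorm_scaleC power_mult_distrib mult.assoc)
  then show "(\<lambda>x. scaleC a (B x)) \<in> ?J" using R_scaleC [OF B] by blast
qed

text \<open>Gliding hump: if no uniform constant existed, the norm-convergent sum of suitably weighted
  bad elements \<open>x - (X ^^ m k) x\<close> would lie in \<open>I\<close>; as these have nonnegative mutual inner
  products, nothing cancels and the sum is not dominated by the quadratic form.\<close>
lemma uniform_domination:
  assumes X: "positive_contraction X"
    and mem: "\<And>m. (\<lambda>x. x - (X ^^ m) x) \<in> I"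
    and dom: "\<And>A. A \<in> I \<Longrightarrow> \<exists>c. \<forall>x. (hnorm (A x))\<^sup>2 \<le> c * Re (cinner (x - X x) x)"
  obtains c where "0 \<le> c"
    "\<And>m x. (hnorm (x - (X ^^ m) x))\<^sup>2 \<le> c * Re (cinner (x - X x) x)"
proof (rule ccontr)
  interpret positive_contraction X by (rule X)
  let ?h = "\<lambda>x. Re (cinner (x - X x) x)"
  have h: "0 \<le> ?h x" for x using le_id [of x] by (simp add: cinner_diff_left)
  assume "\<not> thesis"
  \<comment> \<open>The thresholds 16^(k+2) are matched to the weights (1/2)^(k+2) below: squaring a
    weight costs 4^(k+2), and a factor 4^(k+2) survives to exceed any fixed constant.\<close>
  then have "\<exists>m x. \<not> (hnorm (x - (X ^^ m) x))\<^sup>2 \<le> 16 ^ (k + 2) * ?h x" for k :: nat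
    using that [of "16 ^ (k + 2)"] by fastforce
  then obtain m y where bad: "\<And>k. 16 ^ (k + 2) * ?h (y k) < (hnorm (y k - (X ^^ m k) (y k)))\<^sup>2"
    by (metis not_le)
  \<comment> \<open>The exponent k + 2, not k + 1, absorbs the factor 2 in the norm bound for 1 -
    X^m.\<close>
  define w :: "nat \<Rightarrow> real" where "w k = (1/2) ^ (k + 2)" for k
  define D where "D k x = scaleC (complex_of_real (w k)) (x - (X ^^ m k) x)" for k x
  have D: "D k \<in> I" for k unfolding D_def by (rule I_scaleC [OF mem])
  have D_bound: "hnorm (D k x) \<le> (1/2) ^ Suc k * hnorm x" for k x
  proof -
    have "hnorm (D k x) = w k * hnorm (x - (X ^^ m k) x)"
      by (simp add: D_def hnorm_scaleC w_def del: of_real_power of_real_divide)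
    also have "\<dots> \<le> w k * (2 * hnorm x)"
      using hnorm_triangle_diff [of x "(X ^^ m k) x"] hnorm_funpow_le [of "m k" x]
      by (intro mult_left_mono) (simp_all add: w_def)
    finally show ?thesis by (simp add: w_def mult.commute [of _ "hnorm x"])
  qed
  obtain B where B: "B \<in> I" "\<And>x. hlim (\<lambda>n. \<Sum>k<n. D k x) (B x)"
    by (rule series [of D, OF D D_bound]) blast
  \<comment> \<open>From index k + 1 on, every partial sum is at least as long as its k-th summand,
    and this persists in the limit.\<close>
  have ge: "hnorm (D k x) \<le> hnorm (B x)" for k x
  proof (rule LIMSEQ_le_const [OF hlim_hnorm [OF B(2)]])
    have "hnorm (D k x) \<le> hnorm (\<Sum>k<n. D k x)" if "Suc k \<le> n" for n
      unfolding D_def by (rule hnorm_sum_defect_ge) (use that in \<open>auto simp: w_def\<close>)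
    then show "\<exists>N. \<forall>n\<ge>N. hnorm (D k x) \<le> hnorm (\<Sum>k<n. D k x)" by blast
  qed
  obtain c where c: "\<And>x. (hnorm (B x))\<^sup>2 \<le> c * ?h x" using dom [OF B(1)] by blast
  obtain k where "c < 4 ^ k" using real_arch_pow [of 4 c] by auto
  also have "(4::real) ^ k \<le> 4 ^ (k + 2)" by (rule power_increasing) auto
  finally have k: "c \<le> 4 ^ (k + 2)" by simp
  have "4 ^ (k + 2) * ?h (y k) = (w k)\<^sup>2 * (16 ^ (k + 2) * ?h (y k))"
  proof -
    have "(4::real) ^ (k + 2) = ((1/2)\<^sup>2 * 16) ^ (k + 2)" by (simp add: power2_eq_square)
    also have "\<dots> = (w k)\<^sup>2 * 16 ^ (k + 2)"
      unfolding w_def power_mult_distrib by (simp only: power_mult [symmetric] mult.commute)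
    finally show ?thesis by simp
  qed
  also have "\<dots> < (w k)\<^sup>2 * (hnorm (y k - (X ^^ m k) (y k)))\<^sup>2"
    by (rule mult_strict_left_mono [OF bad]) (simp add: w_def)
  also have "\<dots> = (hnorm (D k (y k)))\<^sup>2"
    by (simp add: D_def hnorm_scaleC power_mult_distrib)
  finally have "4 ^ (k + 2) * ?h (y k) < (hnorm (D k (y k)))\<^sup>2" .
  moreover have "(hnorm (D k (y k)))\<^sup>2 \<le> (hnorm (B (y k)))\<^sup>2"
    by (rule power_mono [OF ge hnorm_ge_0])
  moreover have "c * ?h (y k) \<le> 4 ^ (k + 2) * ?h (y k)"
    by (rule mult_right_mono [OF k h])
  ultimately show False using c [of "y k"] by linarith
qed

section \<open>The support projection and weak-operator closedness\<close>

text \<open>E is a right unit for I: its complement 1 - E projects onto the kernel of H, where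
  domination makes every element of I vanish. Minimality of I, in the form \<open>gen\<close>, is
  tested on the ideal of dominated operators.\<close>

lemma support_projection:
  fixes T :: "nat \<Rightarrow> 'a \<Rightarrow> 'a"
  assumes T: "\<And>k. T k \<in> I" and gen: "\<And>J. left_ideal R J \<Longrightarrow> range T \<subseteq> J \<Longrightarrow> I \<subseteq> J"
  obtains E where "E \<in> I" "projection E" "\<And>A x. A \<in> I \<Longrightarrow> A (E x) = A x"
proof -
  obtain H where H: "H \<in> I" "is_adjoint H H"
    "\<forall>x. 0 \<le> Re (cinner (H x) x)" "\<forall>x. Re (cinner (H x) x) \<le> Re (cinner x x)"
    "\<forall>k. \<exists>c. \<forall>x. (hnorm (T k x))\<^sup>2 \<le> c * Re (cinner (H x) x)"
    by (rule dominating_element [where T = T, OF T])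
  let ?J = "{A \<in> R. \<exists>c. \<forall>x. (hnorm (A x))\<^sup>2 \<le> c * Re (cinner (H x) x)}"
  have "I \<subseteq> ?J"
  proof (rule gen [OF dominated_left_ideal])
    show "range T \<subseteq> ?J" using H(5) I_subset [OF T] by (intro image_subsetI) simp
  qed
  then have dom: "\<exists>c. \<forall>x. (hnorm (A x))\<^sup>2 \<le> c * Re (cinner (H x) x)" if "A \<in> I" for A
    using that by blast
  have H_sym: "cinner (H x) y = cinner x (H y)" for x y using H(2) by (simp add: is_adjoint_def)
  define X where "X x = x - H x" for x
  have H_eq: "H x = x - X x" for x by (simp add: X_def)
  have X_eq: "X = (\<lambda>x. id x + scaleC (-1) (H x))" by (simp add: X_def fun_eq_iff)
  have XR: "X \<in> R" unfolding X_eq by (intro R_add R_id R_scaleC I_subset H(1))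
  interpret positive_contraction X
  proof
    show "bounded_op X" by (rule R_bounded [OF XR])
    show "cinner (X x) y = cinner x (X y)" for x y
      by (simp add: X_def cinner_diff_left cinner_diff_right H_sym)
    show "0 \<le> Re (cinner (X x) x)" for x using H(4) by (simp add: X_def cinner_diff_left)
    show "Re (cinner (X x) x) \<le> Re (cinner x x)" for x
      using H(3) by (simp add: X_def cinner_diff_left)
  qed
  have pow: "X ^^ m \<in> R" for m
    by (induction m) (simp_all only: funpow.simps R_id R_comp [OF XR])
  have defect: "(\<lambda>x. x - (X ^^ m) x) \<in> I" for m
  proof (induction m)
    case (Suc m)
    \<comment> \<open>The splitting 1 - X^(m+1) = (1 - X^m) + X^m H has H as right factor of the new
      term, as a left ideal demands.\<close>
    have "(\<lambda>x. x - (X ^^ Suc m) x) = (\<lambda>x. (x - (X ^^ m) x) + ((X ^^ m) \<circ> H) x)"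
      by (simp add: fun_eq_iff funpow_swap1 H_eq funpow_diff)
    then show ?case using I_add [OF Suc I_comp [OF pow H(1)]] by simp
  qed (simp add: I_zero)
  obtain c where c: "0 \<le> c" "\<And>m x. (hnorm (x - (X ^^ m) x))\<^sup>2 \<le> c * Re (cinner (x - X x) x)"
  proof (rule uniform_domination [OF positive_contraction_axioms defect])
    show "\<exists>c. \<forall>x. (hnorm (A x))\<^sup>2 \<le> c * Re (cinner (x - X x) x)" if "A \<in> I" for A
      using dom [OF that] by (simp add: H_eq)
  qed blast
  have lim0: "(\<lambda>n. sqrt (c / real (Suc n))) \<longlonglongrightarrow> 0"
    using tendsto_real_sqrt [OF LIMSEQ_Suc [OF lim_const_over_n [of c]]] by simp
  obtain E where E: "E \<in> I" "bounded_op E" "\<And>x. hlim (\<lambda>n. x - (X ^^ n) x) (E x)"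
  proof (rule norm_closed_limit [OF closed defect I_bounded [OF defect] _ lim0])
    show "hnorm (x - (X ^^ m) x - (x - (X ^^ n) x)) \<le> sqrt (c / real (Suc n)) * hnorm x"
      if "n \<le> m" for m n x
      using funpow_Cauchy [OF c that, of x] by simp
  qed blast
  have lim: "hlim (\<lambda>n. (X ^^ n) x) (x - E x)" for x
    using hlim_diff [OF hlim_const E(3), of x x] by simp
  \<comment> \<open>Shifting the index shows that the limit of X^n x is fixed by X, that is,
    annihilated by H.\<close>
  have X_fix: "X (x - E x) = x - E x" for x
  proof (rule hlim_unique)
    show "hlim (\<lambda>n. X ((X ^^ n) x)) (X (x - E x))" by (rule hlim_bounded_op [OF bounded lim])
    show "hlim (\<lambda>n. X ((X ^^ n) x)) (x - E x)"
      using lim [of x] LIMSEQ_Suc unfolding hlim_def by fastforce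
  qed
  have kill: "A (x - E x) = 0" if A: "A \<in> I" for A x
  proof -
    obtain d where "(hnorm (A (x - E x)))\<^sup>2 \<le> d * Re (cinner (H (x - E x)) (x - E x))"
      using dom [OF A] by blast
    then show ?thesis by (simp add: H_eq X_fix)
  qed
  have AE: "A (E x) = A x" if "A \<in> I" for A x
    using kill [OF that, of x] by (simp add: bounded_op_diff [OF I_bounded [OF that]])
  have "is_adjoint E E"
    by (rule is_adjoint_limit [OF _ E(3)])
      (simp add: is_adjoint_def cinner_diff_left cinner_diff_right funpow_sym)
  \<comment> \<open>Since E lies in I, the right unit property applied to E itself gives
    idempotence.\<close>
  then have "projection E" using AE [OF E(1)] by (simp add: projection_def fun_eq_iff)
  then show ?thesis using that E(1) AE by blast
qed

text \<open>A weak limit T of elements of I lies in R, because R is weak-operator closed. It also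
  inherits T = T E, which puts it into I.\<close>

lemma wot_closed_if_support:
  assumes E: "E \<in> I" "\<And>A x. A \<in> I \<Longrightarrow> A (E x) = A x"
  shows "wot_closed I"
  unfolding wot_closed_def
proof (intro allI impI, elim conjE)
  fix T assume T: "bounded_op T"
    and near: "\<forall>F. finite F \<longrightarrow> (\<forall>e>0. \<exists>A\<in>I. \<forall>(x, y)\<in>F. cmod (cinner (T x - A x) y) < e)"
  have "\<forall>F. finite F \<longrightarrow> (\<forall>e>0. \<exists>A\<in>R. \<forall>(x, y)\<in>F. cmod (cinner (T x - A x) y) < e)"
    using near I_subset by meson
  then have TR: "T \<in> R" using vn T by (simp add: von_neumann_algebra_def wot_closed_def)
  have "T (E x) = T x" for x
  proof -
    let ?z = "x - E x"
    have "cmod (cinner (T ?z) (T ?z)) < e" if e: "0 < e" for e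
    proof -
      obtain A where A: "A \<in> I" "cmod (cinner (T ?z - A ?z) (T ?z)) < e"
        \<comment> \<open>One pair of vectors suffices: A annihilates \<open>?z\<close>, so
          closeness at (\<open>?z\<close>, \<open>T ?z\<close>) bounds |T ?z|^2 itself.\<close>
        using near [rule_format, of "{(?z, T ?z)}" e] e by auto
      then show ?thesis using E(2) [OF A(1)] by (simp add: bounded_op_diff [OF I_bounded [OF A(1)]])
    qed
    then have "cinner (T ?z) (T ?z) = 0"
      by (metis less_irrefl zero_less_norm_iff)
    then have "T ?z = 0" by (rule cinner_eq_zero)
    then show ?thesis by (simp add: bounded_op_diff [OF T])
  qed
  then have "T = T \<circ> E" by (simp add: fun_eq_iff)
  then show "T \<in> I" using I_comp [OF TR E(1)] by simp
qed

end

theorem theorem3p7: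
  fixes R I :: "('a::chilbert_space \<Rightarrow> 'a) set"
  assumes "von_neumann_algebra R"
    and "left_ideal R I"
    and "norm_closed I"
    and "countably_generated R I"
  shows "wot_closed I \<and> (\<exists>E\<in>R. projection E \<and> I = {A \<circ> E | A. A \<in> R})"
proof -
  interpret closed_left_ideal R I using assms(1-3) by unfold_locales
  obtain S where S: "countable S" "I = gen_left_ideal R S"
    using assms(4) by (auto simp: countably_generated_def)
  \<comment> \<open>Inserting the zero operator makes the enumerated set nonempty even if S is
    empty; every left ideal contains it, so the generated ideal is unchanged.\<close>
  define T where "T = from_nat_into (insert (\<lambda>_. 0) S)"
  have range_T: "range T = insert (\<lambda>_. 0) S" using S(1) by (simp add: T_def)
  have "S \<subseteq> I" unfolding S(2) gen_left_ideal_def by blast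
  then have "range T \<subseteq> I" unfolding range_T using I_zero by simp
  then have T: "T k \<in> I" for k by (rule subsetD) (rule rangeI)
  have gen: "I \<subseteq> J" if "left_ideal R J" "range T \<subseteq> J" for J
    unfolding S(2) gen_left_ideal_def using that range_T by blast
  obtain E where E: "E \<in> I" "projection E" "\<And>A x. A \<in> I \<Longrightarrow> A (E x) = A x"
    using support_projection [where T = T, OF T gen] by blast
  have "I = {A \<circ> E | A. A \<in> R}"
  proof (intro subset_antisym subsetI)
    fix A assume "A \<in> I"
    then have "A = A \<circ> E" by (simp add: fun_eq_iff E(3))
    then show "A \<in> {A \<circ> E | A. A \<in> R}" using I_subset [OF \<open>A \<in> I\<close>] by blast
  qed (use I_comp E(1) in blast)
  moreover have "wot_closed I" by (rule wot_closed_if_support [OF E(1,3)])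
  ultimately show ?thesis using E(1,2) I_subset by blast
qed

end
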